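(* Let $n\ge 3$ and $2\le K\le n$. The inequality $$\sum_{1\le i<j\le n}X_{ij}\ \ge\ \frac{n-K}{2}$$ is valid for the ratio-cut polytope $\mathrm{RCut}^K_n$, and it is facet-defining for $\mathrm{RCut}^K_n$ if and only if $K\le n-1$. Moreover, if $n\ge 4$ and $2\le K\le n-2$, the affine hull of $\mathrm{RCut}^{=K}_n$ is defined by the equation $$\sum_{1\le i<j\le n}X_{ij}=\frac{n-K}{2}.$$
   Context: $[n]=\{1,\dots,n\}$. For a partition $\{\Gamma_k\}_{k=1}^K$ of $[n]$ (pairwise disjoint sets with union $[n]$, some possibly empty), the associated ratio-cut vector $X\in\mathbb{R}^{\binom n2}$ has entries, for $1\le i<j\le n$, $X_{ij}=\frac{1}{|\Gamma_k|}$ if $i$ and $j$ both belong to $\Gamma_k$ for some $k$, and $X_{ij}=0$ if $i,j$ belong to different sets of the partition. The ratio-cut polytope $\mathrm{RCut}^K_n\subset\mathbb{R}^{\binom n2}$ is the convex hull of all ratio-cut vectors corresponding to at most $K$ nonempty clusters. $\mathrm{RCut}^{=K}_n$ is the convex hull of all ratio-cut vectors corresponding to exactly $K$ nonempty clusters. An inequality valid for a polytope $P$ is facet-defining if the set of points of $P$ satisfying it with equality has dimension $\dim(P)-1$. *)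

theory Defs
  imports "HOL-Analysis.Analysis" "HOL-Library.Disjoint_Sets"
begin

definition upper_pairs :: "nat \<Rightarrow> (nat \<times> nat) set" where
  "upper_pairs n = {(i, j). 1 \<le> i \<and> i < j \<and> j \<le> n}"

text \<open>The space of real vectors indexed by the pairs \<open>1 \<le> i < j \<le> n\<close> is represented by
  \<open>real ^ 'e\<close>, where \<open>'e\<close> is any finite type together with a bijective labelling \<open>idx\<close> of its
  elements by these pairs. The coordinate \<open>X\<^sub>i\<^sub>j\<close> is then \<open>X $ idx i j\<close>, and \<open>CARD('e)\<close> is
  \<open>n choose 2\<close>; such a type exists for every \<open>n \<ge> 2\<close>.\<close>

definition pair_indexing :: "nat \<Rightarrow> (nat \<Rightarrow> nat \<Rightarrow> 'e) \<Rightarrow> bool" where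
  "pair_indexing n idx \<longleftrightarrow> bij_betw (\<lambda>(i, j). idx i j) (upper_pairs n) UNIV"

definition is_ratio_cut_vector ::
    "nat \<Rightarrow> (nat \<Rightarrow> nat \<Rightarrow> 'e::finite) \<Rightarrow> nat set set \<Rightarrow> real ^ 'e \<Rightarrow> bool" where
  "is_ratio_cut_vector n idx P X \<longleftrightarrow>
     (\<forall>(i, j)\<in>upper_pairs n.
        (\<forall>C\<in>P. i \<in> C \<and> j \<in> C \<longrightarrow> X $ idx i j = 1 / real (card C)) \<and>
        ((\<nexists>C. C \<in> P \<and> i \<in> C \<and> j \<in> C) \<longrightarrow> X $ idx i j = 0))"

text \<open>Empty clusters do not influence the ratio-cut vector. The blocks of \<open>partition_on\<close> are
  nonempty, so \<open>card P\<close> is the number of nonempty clusters.\<close>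

definition RCut :: "nat \<Rightarrow> (nat \<Rightarrow> nat \<Rightarrow> 'e::finite) \<Rightarrow> nat \<Rightarrow> (real ^ 'e) set" where
  "RCut n idx K =
     convex hull {X. \<exists>P. partition_on {1..n} P \<and> card P \<le> K \<and> is_ratio_cut_vector n idx P X}"

definition RCut_eq :: "nat \<Rightarrow> (nat \<Rightarrow> nat \<Rightarrow> 'e::finite) \<Rightarrow> nat \<Rightarrow> (real ^ 'e) set" where
  "RCut_eq n idx K =
     convex hull {X. \<exists>P. partition_on {1..n} P \<and> card P = K \<and> is_ratio_cut_vector n idx P X}"

definition pair_sum :: "nat \<Rightarrow> (nat \<Rightarrow> nat \<Rightarrow> 'e::finite) \<Rightarrow> real ^ 'e \<Rightarrow> real" where
  "pair_sum n idx X = (\<Sum>(i, j)\<in>upper_pairs n. X $ idx i j)"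

text \<open>Both notions refer to the inequality \<open>f x \<ge> b\<close>, for a linear functional \<open>f\<close>.\<close>

definition valid_inequality :: "'a set \<Rightarrow> ('a \<Rightarrow> real) \<Rightarrow> real \<Rightarrow> bool" where
  "valid_inequality P f b \<longleftrightarrow> (\<forall>x\<in>P. f x \<ge> b)"

definition facet_defining :: "'a::euclidean_space set \<Rightarrow> ('a \<Rightarrow> real) \<Rightarrow> real \<Rightarrow> bool" where
  "facet_defining P f b \<longleftrightarrow>
     valid_inequality P f b \<and> aff_dim {x \<in> P. f x = b} = aff_dim P - 1"

end

theory Submission
  imports Defs
begin

text \<open>
  A cluster \<open>C\<close> contributes \<open>(card C choose 2) / card C = (card C - 1) / 2\<close> to the coordinate sum,
  so the ratio-cut vector of a partition of \<open>[n]\<close> into \<open>p\<close> clusters has coordinate sum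
  \<open>(n - p) / 2\<close>. This gives validity, with equality exactly at the partitions into \<open>K\<close> clusters
  (\<open>inner_one_ratio_cut_vector\<close>, \<open>RCut_sum_ge\<close>).

  Everything else follows from one claim: for \<open>2 \<le> K \<le> n - 1\<close>, the vectors with exactly \<open>K\<close>
  clusters affinely span the whole hyperplane of points with coordinate sum \<open>(n - K) / 2\<close>
  (\<open>affine_hull_ratio_cut_vectors\<close>). To see it, let a linear functional \<open>a\<close> be constant on
  these vectors, and read its coefficients as edge weights on the complete graph. Fix a set \<open>S\<close> of
  \<open>n - K + 2 \<ge> 3\<close> vertices and make every vertex outside \<open>S\<close> a cluster of its own. Then \<open>S\<close>
  remains to be split into two clusters, and all splits give the same value. Splitting off
  one vertex shows that all weighted degrees in \<open>S\<close> agree; splitting off two vertices then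
  shows that all edges in \<open>S\<close> have the same weight (\<open>constant_of_balanced_splits\<close>). As any two
  adjacent edges lie in such a set \<open>S\<close>, the functional is a multiple of the coordinate sum.

  For \<open>K \<le> n - 1\<close> the tight face therefore has codimension one in the ambient space. The polytope
  is full-dimensional, because the one-cluster vector lies off the hyperplane; hence the face is
  a facet. For \<open>K = n\<close> the polytope is still full-dimensional, as it contains the polytope for
  \<open>n - 1\<close>, but the inequality now says that a sum of nonnegative coordinates is at least \<open>0\<close>.
  Its tight face is at most the origin, and the ambient dimension is at least two.
\<close>

section \<open>Edge weights that balance every split of a vertex set\<close>

text \<open>The sum runs over ordered pairs, so for symmetric weights every edge counts twice.\<close>

definition total_weight :: "('a \<Rightarrow> 'a \<Rightarrow> real) \<Rightarrow> 'a set \<Rightarrow> real" where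
  "total_weight w A = (\<Sum>i\<in>A. \<Sum>j\<in>A. w i j)"

lemma total_weight_remove:
  assumes "finite S" "v \<in> S" "\<And>i j. w i j = w j i" "\<And>i. w i i = 0"
  shows "total_weight w (S - {v}) = total_weight w S - 2 * (\<Sum>j\<in>S. w v j)"
proof -
  have "total_weight w S = (\<Sum>i\<in>S. w i v + (\<Sum>j\<in>S - {v}. w i j))"
    unfolding total_weight_def using assms by (intro sum.cong refl) (simp add: sum.remove)
  also have "\<dots> = (\<Sum>i\<in>S. w v i) + ((\<Sum>j\<in>S - {v}. w v j) + total_weight w (S - {v}))"
    unfolding total_weight_def sum.distrib using assms
    by (subst (2) sum.remove[of S v]) auto
  also have "(\<Sum>j\<in>S - {v}. w v j) = (\<Sum>j\<in>S. w v j)"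
    using assms by (simp add: sum.remove[of S v])
  finally show ?thesis by simp
qed

lemma total_weight_single: "w v v = 0 \<Longrightarrow> total_weight w {v} = 0"
  by (simp add: total_weight_def)

lemma total_weight_pair:
  assumes "u \<noteq> v" "\<And>i j. w i j = w j i" "\<And>i. w i i = 0"
  shows "total_weight w {u, v} = 2 * w u v"
  using assms by (simp add: total_weight_def)

text \<open>
  Let \<open>m = card S\<close>. The split \<open>{v}, S - {v}\<close> determines the weighted degree of \<open>v\<close>, which is
  thus a number \<open>r\<close> independent of \<open>v\<close>. In the split \<open>{u, v}, S - {u, v}\<close> the two degrees can
  then be replaced by \<open>r\<close>, which leaves a linear equation for \<open>w u v\<close> alone, with coefficient
  \<open>1 + 2 / (m - 2) \<noteq> 0\<close>.
\<close>

lemma constant_of_balanced_splits: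
  fixes w :: "'a \<Rightarrow> 'a \<Rightarrow> real"
  assumes "finite S" and S3: "card S \<ge> 3"
    and sym: "\<And>i j. w i j = w j i" and diag: "\<And>i. w i i = 0"
    and bal: "\<And>A. \<lbrakk>A \<noteq> {}; A \<subset> S\<rbrakk> \<Longrightarrow>
       total_weight w A / card A + total_weight w (S - A) / card (S - A) = c"
  obtains d where "\<And>u v. \<lbrakk>u \<in> S; v \<in> S; u \<noteq> v\<rbrakk> \<Longrightarrow> w u v = d"
proof -
  define m where "m = real (card S)"
  define T where "T = total_weight w S"
  define r where "r = (T - c * (m - 1)) / 2"
  have m3: "m \<ge> 3" using S3 by (simp add: m_def)
  have deg: "(\<Sum>j\<in>S. w v j) = r" if v: "v \<in> S" for v
  proof -
    have "{v} \<subset> S" using v S3 by (auto simp: psubset_eq)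
    then have "total_weight w (S - {v}) / card (S - {v}) = c"
      using bal[of "{v}"] diag by (simp add: total_weight_single)
    moreover have "real (card (S - {v})) = m - 1"
      using v S3 \<open>finite S\<close> by (simp add: m_def of_nat_diff)
    ultimately have "(T - 2 * (\<Sum>j\<in>S. w v j)) / (m - 1) = c"
      using total_weight_remove[of S v w] v \<open>finite S\<close> sym diag by (simp add: T_def)
    then show ?thesis using m3 by (simp add: r_def field_simps)
  qed
  have "w u v = (c * (m - 2) - T + 4 * r) / m" if uv: "u \<in> S" "v \<in> S" "u \<noteq> v" for u v
  proof -
    have eq: "S - {u, v} = (S - {u}) - {v}" by auto
    have "(\<Sum>j\<in>S - {u}. w v j) = r - w u v"
      using deg[of v] uv \<open>finite S\<close> sym[of v u] by (simp add: sum_diff1)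
    then have Q: "total_weight w (S - {u, v}) = T - 4 * r + 2 * w u v"
      unfolding eq using total_weight_remove[of "S - {u}" v w] total_weight_remove[of S u w]
        uv \<open>finite S\<close> sym diag deg[of u] by (simp add: T_def)
    have "{u, v} \<noteq> S" using S3 uv by auto
    then have "{u, v} \<subset> S" using uv by auto
    then have "total_weight w {u, v} / card {u, v}
        + total_weight w (S - {u, v}) / card (S - {u, v}) = c"
      by (intro bal) auto
    moreover have "real (card (S - {u, v})) = m - 2"
      using uv S3 \<open>finite S\<close> by (simp add: m_def of_nat_diff card_Diff_subset)
    ultimately have "w u v + (T - 4 * r + 2 * w u v) / (m - 2) = c"
      using uv total_weight_pair[of u v w] sym diag by (simp add: Q)
    then have "w u v * m = c * (m - 2) - T + 4 * r" using m3 by (simp add: field_simps)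
    then show ?thesis using m3 by (simp add: field_simps)
  qed
  then show thesis by (rule that)
qed

section \<open>A criterion for spanning a hyperplane\<close>

text \<open>
  If the directions of \<open>S\<close> did not fill the linear hyperplane orthogonal to \<open>c\<close>, that hyperplane
  would contain a nonzero vector orthogonal to all of them. This vector, as a functional, is
  constant on \<open>S\<close>, hence a multiple of \<open>c\<close>, although it is orthogonal to \<open>c\<close>.
\<close>

lemma affine_hull_eq_hyperplane:
  fixes S :: "'a::euclidean_space set"
  assumes sub: "S \<subseteq> {x. c \<bullet> x = b}" and x0: "x0 \<in> S"
    and normal: "\<And>a. (\<And>x. x \<in> S \<Longrightarrow> a \<bullet> x = a \<bullet> x0) \<Longrightarrow> a \<in> span {c}"
  shows "affine hull S = {x. c \<bullet> x = b}"
proof -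
  have on: "c \<bullet> x = b" if "x \<in> S" for x using sub that by blast
  define U where "U = span ((\<lambda>x. - x0 + x) ` S)"
  have hull: "affine hull S = (\<lambda>x. x0 + x) ` U"
    unfolding U_def by (intro affine_hull_span_gen hull_inc x0)
  have UW: "U \<subseteq> {x. c \<bullet> x = 0}"
    unfolding U_def using on[OF x0]
    by (intro span_minimal subspace_hyperplane) (auto simp: inner_simps dest: on)
  have "U = {x. c \<bullet> x = 0}"
  proof (rule ccontr)
    assume "U \<noteq> {x. c \<bullet> x = 0}"
    moreover have "span U = U" by (simp add: U_def)
    moreover have "span {x. c \<bullet> x = 0} = {x. c \<bullet> x = 0}"
      by (simp add: span_eq_iff subspace_hyperplane)
    ultimately have "span U \<subset> span {x. c \<bullet> x = 0}" using UW by blast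
    then obtain a where a: "a \<noteq> 0" "a \<in> span {x. c \<bullet> x = 0}"
      "\<And>y. y \<in> span U \<Longrightarrow> orthogonal a y"
      by (rule orthogonal_to_subspace_exists_gen) blast
    have "c \<bullet> a = 0"
      using a(2) \<open>span {x. c \<bullet> x = 0} = {x. c \<bullet> x = 0}\<close> by simp
    have "a \<bullet> x = a \<bullet> x0" if "x \<in> S" for x
    proof -
      have "- x0 + x \<in> span U" unfolding U_def using that by (auto intro: span_base)
      then show ?thesis using a(3)[of "- x0 + x"] by (simp add: orthogonal_def inner_simps)
    qed
    then obtain k where "a = k *\<^sub>R c" using normal by (auto simp: span_singleton)
    then have "a \<bullet> a = 0" using \<open>c \<bullet> a = 0\<close> by simp
    then show False using a(1) by simp
  qed
  then have "x \<in> (\<lambda>x. x0 + x) ` U \<longleftrightarrow> c \<bullet> x = b" for x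
    using on[OF x0] by (auto simp: inner_simps intro!: image_eqI[of _ _ "x - x0"])
  then show ?thesis unfolding hull by blast
qed

section \<open>Ratio-cut vectors as sums over blocks\<close>

definition block_vector ::
    "nat \<Rightarrow> (nat \<Rightarrow> nat \<Rightarrow> 'e::finite) \<Rightarrow> nat set \<Rightarrow> real ^ 'e" where
  "block_vector n idx C = (\<chi> e. case inv_into (upper_pairs n) (\<lambda>(i, j). idx i j) e of
     (i, j) \<Rightarrow> if i \<in> C \<and> j \<in> C then 1 / real (card C) else 0)"

text \<open>
  The blocks of a partition are disjoint, so at most one summand is nonzero at each coordinate.
  The additive form turns the value of a linear functional into a sum over the blocks.
\<close>

definition ratio_cut_vector ::
    "nat \<Rightarrow> (nat \<Rightarrow> nat \<Rightarrow> 'e::finite) \<Rightarrow> nat set set \<Rightarrow> real ^ 'e" where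
  "ratio_cut_vector n idx P = (\<Sum>C\<in>P. block_vector n idx C)"

text \<open>
  A functional on the pairs \<open>i < j\<close> as a symmetric weight with zero diagonal, so that sums over
  the edges inside a set need no ordering of its vertices.
\<close>

definition edge_weight :: "(nat \<Rightarrow> nat \<Rightarrow> 'e::finite) \<Rightarrow> real ^ 'e \<Rightarrow> nat \<Rightarrow> nat \<Rightarrow> real" where
  "edge_weight idx a i j = (if i < j then a $ idx i j else 0) + (if j < i then a $ idx j i else 0)"

lemma edge_weight_commute: "edge_weight idx a i j = edge_weight idx a j i"
  by (simp add: edge_weight_def)

lemma edge_weight_diag: "edge_weight idx a i i = 0"
  by (simp add: edge_weight_def)

lemma finite_upper_pairs: "finite (upper_pairs n)"
  by (rule finite_subset[of _ "{1..n} \<times> {1..n}"]) (auto simp: upper_pairs_def)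

lemma sum_UNIV_eq_sum_upper_pairs:
  assumes "pair_indexing n idx"
  shows "(\<Sum>e\<in>UNIV. f e) = (\<Sum>(i, j)\<in>upper_pairs n. f (idx i j))"
  using sum.reindex_bij_betw[of "\<lambda>(i, j). idx i j" "upper_pairs n" UNIV f] assms
  by (simp add: pair_indexing_def case_prod_unfold)

lemma pair_indexing_cases:
  assumes "pair_indexing n idx"
  obtains i j where "(i, j) \<in> upper_pairs n" "e = idx i j"
proof -
  have "e \<in> (\<lambda>(i, j). idx i j) ` upper_pairs n"
    using assms by (simp add: pair_indexing_def bij_betw_def)
  then show thesis using that by auto
qed

lemma block_vector_nth:
  assumes "pair_indexing n idx" "(i, j) \<in> upper_pairs n"
  shows "block_vector n idx C $ idx i j = (if i \<in> C \<and> j \<in> C then 1 / real (card C) else 0)"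
proof -
  have "inv_into (upper_pairs n) (\<lambda>(i, j). idx i j) (idx i j) = (i, j)"
    using inv_into_f_f[of "\<lambda>(i, j). idx i j" "upper_pairs n" "(i, j)"] assms
    by (simp add: pair_indexing_def bij_betw_def)
  then show ?thesis by (simp add: block_vector_def)
qed

lemma is_ratio_cut_vector_iff:
  assumes idx: "pair_indexing n idx" and P: "partition_on {1..n} P"
  shows "is_ratio_cut_vector n idx P X \<longleftrightarrow> X = ratio_cut_vector n idx P"
proof -
  have fin: "finite P" using P by (auto intro: finite_elements)
  have uniq: "D = C" if "C \<in> P" "D \<in> P" "i \<in> C" "i \<in> D" for C D i
    using partition_onD2[OF P] that by (auto simp: disjoint_def)
  have in_block: "ratio_cut_vector n idx P $ idx i j = 1 / real (card C)"
    if "(i, j) \<in> upper_pairs n" "C \<in> P" "i \<in> C" "j \<in> C" for i j C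
  proof -
    have "i \<in> D \<longleftrightarrow> D = C" if "D \<in> P" for D
      using uniq \<open>C \<in> P\<close> \<open>i \<in> C\<close> that by blast
    then have "ratio_cut_vector n idx P $ idx i j
        = (\<Sum>D\<in>P. if D = C then 1 / real (card C) else 0)"
      unfolding ratio_cut_vector_def sum_component using that(1,4)
      by (intro sum.cong refl) (simp add: block_vector_nth[OF idx])
    then show ?thesis using fin that by simp
  qed
  have apart: "ratio_cut_vector n idx P $ idx i j = 0"
    if "(i, j) \<in> upper_pairs n" "\<nexists>C. C \<in> P \<and> i \<in> C \<and> j \<in> C" for i j
    unfolding ratio_cut_vector_def sum_component using that
    by (intro sum.neutral) (auto simp: block_vector_nth[OF idx])
  show ?thesis
  proof
    assume X: "is_ratio_cut_vector n idx P X"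
    have "X $ e = ratio_cut_vector n idx P $ e" for e
    proof -
      obtain i j where ij: "(i, j) \<in> upper_pairs n" "e = idx i j"
        using idx by (rule pair_indexing_cases)
      have Xij: "\<And>C. \<lbrakk>C \<in> P; i \<in> C; j \<in> C\<rbrakk> \<Longrightarrow> X $ e = 1 / real (card C)"
          "\<nexists>C. C \<in> P \<and> i \<in> C \<and> j \<in> C \<Longrightarrow> X $ e = 0"
        using bspec[OF X[unfolded is_ratio_cut_vector_def] ij(1)] ij(2) by auto
      show ?thesis
      proof (cases "\<exists>C. C \<in> P \<and> i \<in> C \<and> j \<in> C")
        case True
        then obtain C where "C \<in> P" "i \<in> C" "j \<in> C" by blast
        then show ?thesis using Xij(1) in_block[OF ij(1)] ij(2) by simp
      next
        case False
        then show ?thesis using Xij(2) apart[OF ij(1)] ij(2) by simp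
      qed
    qed
    then show "X = ratio_cut_vector n idx P" by (simp add: vec_eq_iff)
  next
    assume "X = ratio_cut_vector n idx P"
    then show "is_ratio_cut_vector n idx P X"
      unfolding is_ratio_cut_vector_def using in_block apart by auto
  qed
qed

text \<open>
  The factor 2 in the denominator compensates for the ordered pairs in \<open>total_weight\<close>.
\<close>

lemma inner_block_vector:
  assumes idx: "pair_indexing n idx" and C: "C \<subseteq> {1..n}"
  shows "a \<bullet> block_vector n idx C = total_weight (edge_weight idx a) C / (2 * card C)"
proof -
  define g where "g i j = (if i < j then a $ idx i j else 0)" for i j
  have [simp]: "finite C" using C finite_subset by blast
  have "a \<bullet> block_vector n idx C
      = (\<Sum>(i, j)\<in>upper_pairs n. a $ idx i j * block_vector n idx C $ idx i j)"
    by (simp add: inner_vec_def sum_UNIV_eq_sum_upper_pairs[OF idx])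
  also have "\<dots> = (\<Sum>p\<in>upper_pairs n. if p \<in> C \<times> C then g (fst p) (snd p) / card C else 0)"
    by (intro sum.cong refl)
      (auto simp: block_vector_nth[OF idx] g_def upper_pairs_def split: if_splits)
  also have "\<dots> = (\<Sum>p\<in>upper_pairs n \<inter> (C \<times> C). g (fst p) (snd p) / card C)"
    by (simp add: sum.inter_restrict finite_upper_pairs)
  also have "\<dots> = (\<Sum>p\<in>C \<times> C. g (fst p) (snd p) / card C)"
    using C by (intro sum.mono_neutral_left) (auto simp: g_def upper_pairs_def)
  also have "\<dots> = (\<Sum>i\<in>C. \<Sum>j\<in>C. g i j) / card C"
    by (simp add: sum.cartesian_product sum_divide_distrib case_prod_unfold)
  also have "\<dots> = ((\<Sum>i\<in>C. \<Sum>j\<in>C. g i j) + (\<Sum>i\<in>C. \<Sum>j\<in>C. g j i)) / (2 * card C)"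
    by (subst (3) sum.swap) simp
  also have "\<dots> = total_weight (edge_weight idx a) C / (2 * card C)"
    by (simp add: total_weight_def edge_weight_def g_def sum.distrib)
  finally show ?thesis .
qed

lemma inner_ratio_cut_vector:
  assumes "pair_indexing n idx" "partition_on {1..n} P"
  shows "a \<bullet> ratio_cut_vector n idx P
    = (\<Sum>C\<in>P. total_weight (edge_weight idx a) C / (2 * card C))"
  unfolding ratio_cut_vector_def inner_sum_right
  using assms partition_onD1[OF assms(2)] by (intro sum.cong refl inner_block_vector) auto

lemma pair_sum_eq_inner:
  assumes "pair_indexing n idx"
  shows "pair_sum n idx X = 1 \<bullet> X"
  by (simp add: pair_sum_def inner_vec_def sum_UNIV_eq_sum_upper_pairs[OF assms])

text \<open>
  A block with \<open>k\<close> elements has \<open>k * (k - 1)\<close> ordered pairs, each weighted by \<open>1 / (2 * k)\<close>,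
  and the sizes of the blocks add up to \<open>n\<close>.
\<close>

lemma inner_one_ratio_cut_vector:
  assumes idx: "pair_indexing n idx" and P: "partition_on {1..n} P"
  shows "1 \<bullet> ratio_cut_vector n idx P = (real n - real (card P)) / 2"
proof -
  have block: "total_weight (edge_weight idx 1) C / (2 * card C) = (real (card C) - 1) / 2"
    if "C \<in> P" for C
  proof -
    have C: "finite C" "C \<noteq> {}"
      using P that finite_subset[of C "{1..n}"] by (auto simp: partition_on_def)
    have "total_weight (edge_weight idx 1) C = (\<Sum>i\<in>C. \<Sum>j\<in>C - {i}. 1)"
      unfolding total_weight_def using C
      by (intro sum.cong refl sum.mono_neutral_cong_right) (auto simp: edge_weight_def)
    also have "\<dots> = real (card C) * (real (card C) - 1)"
      using C by (simp add: of_nat_diff Suc_leI card_gt_0_iff)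
    finally show ?thesis using C by simp
  qed
  have "n = (\<Sum>C\<in>P. card C)"
    using product_partition[OF P finite_subset[of _ "{1..n}"]] partition_onD1[OF P] by auto
  then have "real n = (\<Sum>C\<in>P. real (card C))" by simp
  moreover have "1 \<bullet> ratio_cut_vector n idx P = (\<Sum>C\<in>P. (real (card C) - 1) / 2)"
    unfolding inner_ratio_cut_vector[OF idx P] by (intro sum.cong refl block)
  ultimately show ?thesis by (simp add: sum_subtractf flip: sum_divide_distrib)
qed

section \<open>The affine hull of the vectors with exactly \<open>K\<close> clusters\<close>

text \<open>
  The test partitions: \<open>S\<close> is cut into two parts and every other point is isolated. For
  \<open>card V = n\<close> and \<open>card S = n - K + 2\<close> they have \<open>K\<close> blocks.
\<close>

lemma partition_on_split_and_singletons:
  assumes S: "S \<subseteq> V" and "finite V" and A: "A \<noteq> {}" "A \<subset> S"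
  defines "R \<equiv> (\<lambda>x. {x}) ` (V - S)"
  shows "partition_on V (insert A (insert (S - A) R))"
    and "A \<notin> insert (S - A) R" and "S - A \<notin> R"
    and "card (insert A (insert (S - A) R)) = card V - card S + 2"
proof -
  show "partition_on V (insert A (insert (S - A) R))"
    using S A by (intro partition_onI) (auto simp: R_def disjnt_def)
  show *: "A \<notin> insert (S - A) R" "S - A \<notin> R" using A by (auto simp: R_def)
  have "card R = card V - card S"
    using S finite_subset[OF S \<open>finite V\<close>] by (simp add: R_def card_image card_Diff_subset)
  moreover have "finite R" using \<open>finite V\<close> by (simp add: R_def)
  ultimately show "card (insert A (insert (S - A) R)) = card V - card S + 2"
    using * by simp
qed

text \<open>
  Singletons contribute nothing, so on the test partitions the functional only sees the two
  parts of \<open>S\<close>, and \<open>constant_of_balanced_splits\<close> applies. The bound \<open>K < n\<close> lets \<open>S\<close> contain any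
  three given vertices, and \<open>2 \<le> K\<close> lets \<open>S\<close> fit into \<open>[n]\<close>.
\<close>

lemma coefficients_constant:
  fixes idx :: "nat \<Rightarrow> nat \<Rightarrow> 'e::finite"
  assumes idx: "pair_indexing n idx" and K: "2 \<le> K" "K < n"
    and const: "\<And>P. \<lbrakk>partition_on {1..n} P; card P = K\<rbrakk> \<Longrightarrow> a \<bullet> ratio_cut_vector n idx P = c"
  shows "a \<in> span {1}"
proof -
  define w where "w = edge_weight idx a"
  have sym: "w i j = w j i" and diag: "w i i = 0" for i j
    by (simp_all add: w_def edge_weight_commute edge_weight_diag)
  have adjacent: "w i j = w i k"
    if ijk: "{i, j, k} \<subseteq> {1..n}" "i \<noteq> j" "i \<noteq> k" for i j k
  proof -
    have "card {i, j, k} \<le> 3" by (simp add: card_insert_if)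
    then have "card {i, j, k} \<le> n - K + 2" using K by linarith
    moreover have "n - K + 2 \<le> card {1..n}" using K by simp
    ultimately obtain S where S: "{i, j, k} \<subseteq> S" "S \<subseteq> {1..n}" "card S = n - K + 2"
      using exists_subset_between[OF _ _ ijk(1)] by (metis finite_atLeastAtMost)
    then have fin: "finite S" using finite_subset by blast
    have bal: "total_weight w A / card A + total_weight w (S - A) / card (S - A) = 2 * c"
      if A: "A \<noteq> {}" "A \<subset> S" for A
    proof -
      define R where "R = (\<lambda>x. {x}) ` ({1..n} - S)"
      define P where "P = insert A (insert (S - A) R)"
      note part = partition_on_split_and_singletons[OF S(2) _ A, folded R_def, folded P_def]
      have "card P = K" using part(4) S(3) K by simp
      then have "2 * c = 2 * (a \<bullet> ratio_cut_vector n idx P)" using const part(1) by simp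
      also have "\<dots> = (\<Sum>C\<in>P. total_weight w C / card C)"
        by (simp add: inner_ratio_cut_vector[OF idx part(1)] w_def sum_distrib_left)
      also have "\<dots> = total_weight w A / card A + (total_weight w (S - A) / card (S - A)
          + (\<Sum>C\<in>R. total_weight w C / card C))"
      proof -
        have "finite R" by (simp add: R_def)
        then show ?thesis using part(2,3) by (simp add: P_def)
      qed
      also have "(\<Sum>C\<in>R. total_weight w C / card C) = 0"
        by (intro sum.neutral) (auto simp: R_def total_weight_single diag)
      finally show ?thesis by simp
    qed
    have "card S \<ge> 3" using S(3) K by simp
    then obtain d where "\<And>u v. \<lbrakk>u \<in> S; v \<in> S; u \<noteq> v\<rbrakk> \<Longrightarrow> w u v = d"
      using constant_of_balanced_splits[of S w "2 * c", OF fin _ sym diag bal] by blast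
    then show ?thesis using S(1) ijk by simp
  qed
  \<comment> \<open>Any edge \<open>ij\<close> is linked to the edge \<open>12\<close> by the chain \<open>ij\<close>, \<open>1j\<close>, \<open>12\<close> of adjacent edges;
      \<open>j \<noteq> 1\<close> because \<open>1 \<le> i < j\<close>.\<close>
  have coeff: "a $ idx i j = w 1 2" if ij: "(i, j) \<in> upper_pairs n" for i j
  proof -
    have b: "i \<in> {1..n}" "j \<in> {1..n}" "i < j" "1 \<in> {1..n}" "2 \<in> {1..n}"
      using ij K by (auto simp: upper_pairs_def)
    have "a $ idx i j = w i j" using b by (simp add: w_def edge_weight_def)
    also have "\<dots> = w 1 j"
      using adjacent[of j i 1] sym[of j i] sym[of j 1] b by auto
    also have "\<dots> = w 1 2"
      using adjacent[of 1 j 2] b by auto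
    finally show ?thesis .
  qed
  have "a = w 1 2 *\<^sub>R 1"
  proof -
    have "a $ e = w 1 2" for e
      using coeff by (cases rule: pair_indexing_cases[OF idx, of e]) auto
    then show ?thesis by (simp add: vec_eq_iff)
  qed
  then show ?thesis by (metis span_base span_scale singletonI)
qed

abbreviation ratio_cut_vectors ::
    "nat \<Rightarrow> (nat \<Rightarrow> nat \<Rightarrow> 'e::finite) \<Rightarrow> nat \<Rightarrow> (real ^ 'e) set" where
  "ratio_cut_vectors n idx K \<equiv>
     {ratio_cut_vector n idx P |P. partition_on {1..n} P \<and> card P = K}"

lemma RCut_eq_hull:
  assumes "pair_indexing n idx"
  shows "RCut_eq n idx K = convex hull (ratio_cut_vectors n idx K)"
  unfolding RCut_eq_def using is_ratio_cut_vector_iff[OF assms]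
  by (intro arg_cong[where f = "(hull) convex"]) blast

lemma RCut_hull:
  assumes "pair_indexing n idx"
  shows "RCut n idx K =
    convex hull {ratio_cut_vector n idx P |P. partition_on {1..n} P \<and> card P \<le> K}"
  unfolding RCut_def using is_ratio_cut_vector_iff[OF assms]
  by (intro arg_cong[where f = "(hull) convex"]) blast

lemma affine_hull_ratio_cut_vectors:
  fixes idx :: "nat \<Rightarrow> nat \<Rightarrow> 'e::finite"
  assumes idx: "pair_indexing n idx" and K: "2 \<le> K" "K < n"
  shows "affine hull (ratio_cut_vectors n idx K) = {X. 1 \<bullet> X = (real n - real K) / 2}"
proof -
  \<comment> \<open>The criterion needs a base point, that is, some partition into \<open>K\<close> blocks.\<close>
  have "n - K + 2 \<le> card {1..n}" using K by simp
  then obtain S where S: "S \<subseteq> {1..n}" "card S = n - K + 2"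
    using obtain_subset_with_card_n by metis
  then obtain x where x: "x \<in> S" by fastforce
  have "{x} \<subset> S" using x S K by (auto simp: psubset_eq)
  from partition_on_split_and_singletons[OF S(1) _ _ this]
  obtain P0 where P0: "partition_on {1..n} P0" "card P0 = K"
    using S(2) K by fastforce
  show ?thesis
  proof (rule affine_hull_eq_hyperplane)
    show "ratio_cut_vectors n idx K \<subseteq> {X. 1 \<bullet> X = (real n - real K) / 2}"
      using inner_one_ratio_cut_vector[OF idx] by auto
    show "ratio_cut_vector n idx P0 \<in> ratio_cut_vectors n idx K" using P0 by blast
    show "a \<in> span {1}" if "\<And>x. x \<in> ratio_cut_vectors n idx K \<Longrightarrow>
        a \<bullet> x = a \<bullet> ratio_cut_vector n idx P0" for a
      using that by (intro coefficients_constant[OF idx K]) blast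
  qed
qed

section \<open>Validity and facets\<close>

lemma RCut_mono:
  assumes "K \<le> L"
  shows "RCut n idx K \<subseteq> RCut n idx L"
  unfolding RCut_def using assms by (intro hull_mono) (blast intro: order_trans)

lemma ratio_cut_vectors_subset_RCut:
  assumes "pair_indexing n idx"
  shows "ratio_cut_vectors n idx K \<subseteq> RCut n idx K"
  unfolding RCut_hull[OF assms] by (rule subset_trans[OF _ hull_subset]) blast

lemma RCut_sum_ge:
  assumes idx: "pair_indexing n idx" and X: "X \<in> RCut n idx K"
  shows "1 \<bullet> X \<ge> (real n - real K) / 2"
proof -
  have "RCut n idx K \<subseteq> {X. 1 \<bullet> X \<ge> (real n - real K) / 2}"
    unfolding RCut_hull[OF idx]
    by (intro hull_minimal convex_halfspace_ge) (auto simp: inner_one_ratio_cut_vector[OF idx])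
  then show ?thesis using X by blast
qed

lemma RCut_nonneg:
  fixes idx :: "nat \<Rightarrow> nat \<Rightarrow> 'e::finite"
  assumes idx: "pair_indexing n idx" and X: "X \<in> RCut n idx K"
  shows "X $ e \<ge> 0"
proof -
  have "block_vector n idx C $ e \<ge> 0" for C
    by (simp add: block_vector_def split: prod.split)
  then have "RCut n idx K \<subseteq> {X. axis e 1 \<bullet> X \<ge> 0}"
    unfolding RCut_hull[OF idx]
    by (intro hull_minimal convex_halfspace_ge)
       (auto simp: inner_axis' ratio_cut_vector_def sum_component intro!: sum_nonneg)
  then show ?thesis using X by (auto simp: inner_axis')
qed

lemma aff_dim_sum_hyperplane:
  "aff_dim {X :: real ^ 'e::finite. 1 \<bullet> X = b} = int CARD('e) - 1"
proof -
  have "(1 :: real ^ 'e) \<noteq> 0" by (simp add: vec_eq_iff)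
  then show ?thesis
    using zero_less_card_finite[where 'a = 'e]
    by (simp add: aff_dim_hyperplane of_nat_diff Suc_leI)
qed

lemma aff_dim_ratio_cut_vectors:
  fixes idx :: "nat \<Rightarrow> nat \<Rightarrow> 'e::finite"
  assumes "pair_indexing n idx" "2 \<le> K" "K < n"
  shows "aff_dim (ratio_cut_vectors n idx K) = int CARD('e) - 1"
  by (subst aff_dim_affine_hull[symmetric])
     (simp only: affine_hull_ratio_cut_vectors[OF assms] aff_dim_sum_hyperplane)

text \<open>
  The ratio-cut vectors with exactly \<open>L\<close> clusters span a hyperplane when \<open>2 \<le> L < n\<close>, and the
  one-cluster vector lies off it. For \<open>K = n\<close> this is applied to \<open>L = n - 1\<close>.
\<close>

lemma aff_dim_RCut:
  fixes idx :: "nat \<Rightarrow> nat \<Rightarrow> 'e::finite"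
  assumes idx: "pair_indexing n idx" and K: "2 \<le> K" "K \<le> n" "n \<ge> 3"
  shows "aff_dim (RCut n idx K) = int CARD('e)"
proof -
  define L where "L = min K (n - 1)"
  have L: "2 \<le> L" "L < n" "L \<le> K" using K by (auto simp: L_def)
  let ?H = "{X :: real ^ 'e. 1 \<bullet> X = (real n - real L) / 2}"
  define x1 where "x1 = ratio_cut_vector n idx {{1..n}}"
  have one: "partition_on {1..n} {{1..n}}" using K by (intro partition_onI) auto
  have x1: "x1 \<in> RCut n idx L"
    unfolding RCut_hull[OF idx] x1_def using one L by (intro hull_inc) force
  have "x1 \<notin> ?H" using inner_one_ratio_cut_vector[OF idx one] L by (simp add: x1_def)
  then have "x1 \<notin> affine hull (ratio_cut_vectors n idx L)"
    unfolding affine_hull_ratio_cut_vectors[OF idx L(1,2)] .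
  then have "aff_dim (insert x1 (ratio_cut_vectors n idx L))
      = aff_dim (ratio_cut_vectors n idx L) + 1"
    by (simp only: aff_dim_insert if_False)
  also have "aff_dim (ratio_cut_vectors n idx L) = int CARD('e) - 1"
    by (rule aff_dim_ratio_cut_vectors[OF idx L(1,2)])
  finally have "int CARD('e) = aff_dim (insert x1 (ratio_cut_vectors n idx L))" by simp
  also have "\<dots> \<le> aff_dim (RCut n idx K)"
    using x1 ratio_cut_vectors_subset_RCut[OF idx] RCut_mono[OF L(3)]
    by (intro aff_dim_subset) blast
  finally show ?thesis using aff_dim_le_DIM[of "RCut n idx K"] by simp
qed

lemma aff_dim_tight_face:
  fixes idx :: "nat \<Rightarrow> nat \<Rightarrow> 'e::finite"
  assumes idx: "pair_indexing n idx" and K: "2 \<le> K" "K < n"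
  shows "aff_dim {X \<in> RCut n idx K. 1 \<bullet> X = (real n - real K) / 2} = int CARD('e) - 1"
    (is "aff_dim ?F = _")
proof -
  let ?H = "{X :: real ^ 'e. 1 \<bullet> X = (real n - real K) / 2}"
  have hyp: "aff_dim ?H = int CARD('e) - 1" by (rule aff_dim_sum_hyperplane)
  have hull: "affine hull (ratio_cut_vectors n idx K) = ?H"
    by (rule affine_hull_ratio_cut_vectors[OF idx K])
  have "ratio_cut_vectors n idx K \<subseteq> ?F"
    using ratio_cut_vectors_subset_RCut[OF idx] hull_subset[of "ratio_cut_vectors n idx K" affine]
    unfolding hull by blast
  from aff_dim_subset[OF this] have "aff_dim ?H \<le> aff_dim ?F"
    unfolding hyp aff_dim_ratio_cut_vectors[OF idx K] .
  moreover have "aff_dim ?F \<le> aff_dim ?H" by (intro aff_dim_subset) blast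
  ultimately show ?thesis using hyp by simp
qed

text \<open>
  The case \<open>K = n\<close> of the tight face: nonnegative coordinates with sum zero all vanish.
\<close>

lemma aff_dim_face_le_0:
  assumes idx: "pair_indexing n idx"
  shows "aff_dim {X \<in> RCut n idx K. 1 \<bullet> X = 0} \<le> 0"
proof -
  have "X = 0" if X: "X \<in> RCut n idx K" "1 \<bullet> X = 0" for X
  proof -
    have "(\<Sum>e\<in>UNIV. X $ e) = 0" using X(2) by (simp add: inner_vec_def)
    then have "\<forall>e\<in>UNIV. X $ e = 0"
      using RCut_nonneg[OF idx X(1)] by (subst (asm) sum_nonneg_eq_0_iff) auto
    then show ?thesis by (simp add: vec_eq_iff)
  qed
  then have "{X \<in> RCut n idx K. 1 \<bullet> X = 0} \<subseteq> {0}" by blast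
  from aff_dim_subset[OF this] show ?thesis by simp
qed

lemma two_le_card_pairs:
  fixes idx :: "nat \<Rightarrow> nat \<Rightarrow> 'e::finite"
  assumes "pair_indexing n idx" "n \<ge> 3"
  shows "CARD('e) \<ge> 2"
proof -
  have "card {(1::nat, 2::nat), (1, 3)} \<le> card (upper_pairs n)"
    using assms(2) by (intro card_mono finite_upper_pairs) (auto simp: upper_pairs_def)
  moreover have "card (upper_pairs n) = CARD('e)"
    using assms(1) bij_betw_same_card by (auto simp: pair_indexing_def)
  ultimately show ?thesis by simp
qed

theorem proposition2:
  fixes n K :: nat and idx :: "nat \<Rightarrow> nat \<Rightarrow> 'e::finite"
  assumes "pair_indexing n idx"
    and "n \<ge> 3" and "2 \<le> K" and "K \<le> n"
  shows "valid_inequality (RCut n idx K) (pair_sum n idx) ((real n - real K) / 2) \<and>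
    (facet_defining (RCut n idx K) (pair_sum n idx) ((real n - real K) / 2)
       \<longleftrightarrow> K \<le> n - 1) \<and>
    (n \<ge> 4 \<and> K \<le> n - 2 \<longrightarrow>
       affine hull (RCut_eq n idx K) = {X. pair_sum n idx X = (real n - real K) / 2})"
proof (intro conjI impI)
  note idx = assms(1)
  note sum_eq = pair_sum_eq_inner[OF idx]
  show valid: "valid_inequality (RCut n idx K) (pair_sum n idx) ((real n - real K) / 2)"
    using RCut_sum_ge[OF idx] by (simp add: valid_inequality_def sum_eq)
  note dim = aff_dim_RCut[OF idx assms(3,4,2)]
  show "facet_defining (RCut n idx K) (pair_sum n idx) ((real n - real K) / 2) \<longleftrightarrow> K \<le> n - 1"
  proof
    assume "K \<le> n - 1"
    then have "K < n" using assms(2) by simp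
    then show "facet_defining (RCut n idx K) (pair_sum n idx) ((real n - real K) / 2)"
      using valid aff_dim_tight_face[OF idx assms(3)] dim by (simp add: facet_defining_def sum_eq)
  next
    assume facet: "facet_defining (RCut n idx K) (pair_sum n idx) ((real n - real K) / 2)"
    show "K \<le> n - 1"
    proof (rule ccontr)
      assume "\<not> K \<le> n - 1"
      then have "K = n" using assms(4) by simp
      then show False
        using facet dim aff_dim_face_le_0[OF idx, of n] two_le_card_pairs[OF idx assms(2)]
        by (simp add: facet_defining_def sum_eq)
    qed
  qed
  show "affine hull (RCut_eq n idx K) = {X. pair_sum n idx X = (real n - real K) / 2}"
    if "n \<ge> 4 \<and> K \<le> n - 2"
    unfolding RCut_eq_hull[OF idx] sum_eq affine_hull_convex_hull
    using that assms(2) by (intro affine_hull_ratio_cut_vectors[OF idx assms(3)]) arith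
qed

end
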